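(* Let $f$ and $g$ be two (formal) power series in the same indeterminate $x$ with coefficients in a commutative ring $R$. Then $$f\ast g=\sum_{k=0}^{\infty}\sigma_k\,\delta_k\cdot\Big(\big(x^k\,\delta_k\big)\odot\big(\bar S_k\, f\big)\odot\big(\bar S_k\, g\big)\Big)=\sum_{k=0}^{\infty}\sigma_k\,\delta_k\cdot\Big(\big(x^k\,\delta_k\big)\odot\big(S_k\,\bar f\big)\odot\big(S_k\,\bar g\big)\Big),$$ where $f\ast g$ is the convolution (ordinary Cauchy product) of $f$ and $g$, juxtaposition and $\cdot$ denote the ordinary product of power series, and the infinite sums are taken coefficientwise in $R[[x]]$.
   Context: Notation. For power series $u=\sum_j u_jx^j$ and $v=\sum_j v_jx^j$, the termwise product is $u\odot v=\sum_j u_jv_jx^j$; in an expression mixing juxtaposition and $\odot$, the ordinary products (juxtaposition) are computed first. Sierpiński's polynomials: for $m\ge 0$, $S_m=\sum_{j=0}^m T_{m,j}x^j$, where $T_{m,j}\in\{0,1\}$ is the residue of $\binom{m}{j}$ modulo $2$ (read as an integer). The power series $\delta_k$ is the expansion of $(1-x)^{-1}S_k^{-1}$, i.e. $\delta_k=\dfrac{1}{(1-x)S_k}\in\mathbb Z[[x]]$. Signed Thue–Morse sequence: $\sigma_j=(-1)^{h(j)}$, where $h(j)$ is the number of digits $1$ in the binary expansion of $j\ge0$. For a power series $f=\sum_j a_jx^j$, $\bar f=\sum_j \sigma_ja_jx^j$. For $m=\sum_i d_i2^i$ with binary digits $d_i\in\{0,1\}$, $\bar S_m=\prod_i(1-x^{2^i})^{d_i}$.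 Integer-coefficient series are regarded as having coefficients in $R$ via the canonical map $\mathbb Z\to R$. *)

theory Defs
  imports "HOL-Computational_Algebra.Computational_Algebra"
begin

definition termwise :: "'a::times fps \<Rightarrow> 'a fps \<Rightarrow> 'a fps"  (infixl \<open>\<odot>\<close> 70)
  where "u \<odot> v = Abs_fps (\<lambda>j. u $ j * v $ j)"

text \<open>Reading an integer series in \<open>R[[x]]\<close> along the canonical map from the integers to \<open>R\<close>.\<close>

definition fps_from_int :: "int fps \<Rightarrow> 'a::ring_1 fps"
  where "fps_from_int u = Abs_fps (\<lambda>j. of_int (u $ j))"

definition sierpinski :: "nat \<Rightarrow> int fps"
  where "sierpinski m = (\<Sum>j\<le>m. fps_const (int ((m choose j) mod 2)) * fps_X ^ j)"

lemma fps_nth_sierpinski: "sierpinski m $ n = int ((m choose n) mod 2)"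
proof -
  have "sierpinski m $ n =
      (\<Sum>j\<le>m. if n = j then int ((m choose j) mod 2) else 0)"
    unfolding sierpinski_def fps_sum_nth fps_mult_left_const_nth fps_X_power_nth
    by (intro sum.cong) auto
  also have "\<dots> = int ((m choose n) mod 2)"
    by (simp add: binomial_eq_0)
  finally show ?thesis .
qed

text \<open>
  The type of integers has no \<open>inverse\<close> operation. The series below is the inverse
  with constant term \<open>1\<close>, computed in the ring of integer power series.
\<close>

definition delta :: "nat \<Rightarrow> int fps"
  where "delta k = fps_right_inverse ((1 - fps_X) * sierpinski k) 1"

lemma delta_inverse: "(1 - fps_X) * sierpinski k * delta k = 1"
  unfolding delta_def by (rule fps_right_inverse) (simp add: fps_nth_sierpinski)

text \<open>In binary, \<open>bit j i\<close> says that the digit of weight \<open>2 ^ i\<close> in \<open>j\<close> is \<open>1\<close>.\<close>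

lemma finite_bits_nat: "finite {i. bit (j::nat) i}"
proof (rule finite_subset)
  show "{i. bit j i} \<subseteq> {..j}"
  proof
    fix i assume "i \<in> {i. bit j i}"
    then have "odd (j div 2 ^ i)"
      by (simp add: bit_iff_odd)
    then have "j div 2 ^ i \<noteq> 0"
      by (metis even_zero)
    then have "2 ^ i \<le> j"
      by (metis div_less not_le)
    then show "i \<in> {..j}"
      using less_le_trans[OF less_exp] by (simp add: order_less_imp_le)
  qed
qed simp

definition thue_morse :: "nat \<Rightarrow> int"
  where "thue_morse j = (-1) ^ card {i. bit j i}"

definition fps_bar :: "'a::ring_1 fps \<Rightarrow> 'a fps"
  where "fps_bar f = Abs_fps (\<lambda>j. of_int (thue_morse j) * f $ j)"

text \<open>A digit \<open>0\<close> contributes the factor \<open>1\<close>, so only the digits \<open>1\<close> occur in the product.\<close>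

definition sierpinski_bar :: "nat \<Rightarrow> int fps"
  where "sierpinski_bar m = (\<Prod>i | bit m i. 1 - fps_X ^ (2 ^ i))"

end

theory Submission
  imports Defs "HOL-Library.Nat_Bijection"
begin

text \<open>
  Read natural numbers as bit masks. Each series in the identity is then, up to signs, the
  indicator of a relation between masks: the coefficient of \<open>x\<^sup>j\<close> is

    \<^item> in \<^term>\<open>sierpinski k\<close>: \<open>1\<close> if \<open>j\<close> is a submask of \<open>k\<close>, else \<open>0\<close> (Lucas' theorem modulo \<open>2\<close>);
    \<^item> in \<^term>\<open>sierpinski_bar k\<close>: the same, times the sign \<^term>\<open>thue_morse j\<close>;
    \<^item> in \<^term>\<open>delta k\<close>: \<open>1\<close> if \<open>j\<close> and \<open>k\<close> are disjoint, else \<open>0\<close>;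
    \<^item> in \<^term>\<open>fps_X ^ k * delta k\<close>: \<open>1\<close> if \<open>k\<close> is a submask of \<open>j\<close>, else \<open>0\<close>.

  Write \<open>\<sigma>\<close> for the Thue--Morse sign. If \<open>k\<close> is a submask of \<open>j\<close>, then for \<open>a \<le> j\<close> the number
  \<open>j - a\<close> is a submask of \<open>k\<close> exactly if \<open>a OR k = j\<close>. So in the product with a Sierpinski polynomial
  the coefficient of \<open>x\<^sup>j\<close> collects the \<open>f\<^sub>a\<close> with \<open>a OR k = j\<close>, and likewise the \<open>g\<^sub>b\<close> with
  \<open>b OR k = j\<close>. In the second form of the identity the sign attached to \<open>f\<^sub>a g\<^sub>b\<close> is \<open>\<sigma>\<^sub>a \<sigma>\<^sub>b\<close> by
  definition; in the first it is the product of the signs of \<open>j - a\<close> and \<open>j - b\<close>. These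
  numbers are the complements of \<open>a\<close> and \<open>b\<close> within \<open>j\<close>, with signs \<open>\<sigma>\<^sub>j \<sigma>\<^sub>a\<close> and \<open>\<sigma>\<^sub>j \<sigma>\<^sub>b\<close>, so
  \<open>\<sigma>\<^sub>j\<close> occurs twice and cancels, leaving \<open>\<sigma>\<^sub>a \<sigma>\<^sub>b\<close> again. Hence in both forms, in the coefficient
  of \<open>x\<^sup>n\<close>, the factor of \<open>f\<^sub>a g\<^sub>b\<close> is \<open>\<sigma>\<^sub>a \<sigma>\<^sub>b\<close> times the sum of \<open>\<sigma>\<^sub>k\<close> over all \<open>k\<close>, \<open>p\<close> with

    \<open>a OR k = b OR k\<close>, \<open>p AND k = 0\<close>, \<open>p + (a OR k) = n\<close>.

  It remains to see that this sum is \<open>\<sigma>\<^sub>a \<sigma>\<^sub>b\<close> if \<open>a + b = n\<close> and \<open>0\<close> otherwise. As a generating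
  function in \<open>n\<close> it factors over the binary digits (lemma \<open>signed_mask_sum\<close> does this one digit
  at a time). With \<open>y = x^(2^i)\<close>, the factor of the digit \<open>i\<close> is

    \<^item> \<open>- y\<close> if \<open>a\<close> and \<open>b\<close> differ there, since \<open>k\<close> must have the digit \<open>1\<close> and \<open>p\<close> the digit \<open>0\<close>;
    \<^item> \<open>y (1 + y) - y = y\<^sup>2\<close> if both have the digit \<open>1\<close>, by summing over the digit of \<open>k\<close>;
    \<^item> \<open>(1 + y) - y = 1\<close> if both have the digit \<open>0\<close>.

  The product of these factors is \<open>\<sigma>\<^sub>a \<sigma>\<^sub>b x\<^bsup>a + b\<^esup>\<close>. The second case is where the carries of the
  addition \<open>a + b\<close> come from.
\<close>

unbundle bit_operations_syntax

section \<open>The Thue--Morse sign\<close>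

lemma thue_morse_double: "thue_morse (2 * k) = thue_morse k"
proof -
  have "{i. bit (2 * k) i} = Suc ` {i. bit k i}"
  proof (rule set_eqI)
    show "i \<in> {i. bit (2 * k) i} \<longleftrightarrow> i \<in> Suc ` {i. bit k i}" for i
      by (cases i) (auto simp: bit_0 bit_Suc)
  qed
  then show ?thesis
    by (simp add: thue_morse_def card_image)
qed

lemma thue_morse_Suc_double: "thue_morse (Suc (2 * k)) = - thue_morse k"
proof -
  have "{i. bit (Suc (2 * k)) i} = insert 0 (Suc ` {i. bit k i})"
  proof (rule set_eqI)
    show "i \<in> {i. bit (Suc (2 * k)) i} \<longleftrightarrow> i \<in> insert 0 (Suc ` {i. bit k i})" for i
      by (cases i) (auto simp: bit_0 bit_Suc)
  qed
  then show ?thesis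
    by (simp add: thue_morse_def card_image finite_bits_nat)
qed

lemma thue_morse_square: "thue_morse a * thue_morse a = 1"
  by (simp add: thue_morse_def flip: power_add)

text \<open>Adding disjoint masks produces no carries, so the digit sets are united.\<close>

lemma thue_morse_add_disjoint:
  assumes "a AND b = (0::nat)"
  shows "thue_morse (a + b) = thue_morse a * thue_morse b"
proof -
  have "{i. bit (a + b) i} = {i. bit a i} \<union> {i. bit b i}"
    using assms by (auto simp: disjunctive_add_eq_or bit_or_iff)
  moreover have "{i. bit a i} \<inter> {i. bit b i} = {}"
    using assms by (auto simp: bit_eq_iff bit_and_iff)
  ultimately show ?thesis
    by (simp add: thue_morse_def card_Un_disjoint finite_bits_nat power_add)
qed

section \<open>Submasks\<close>

text \<open>
  The equation \<open>i AND j = i\<close> says that the digits \<open>1\<close> of \<open>i\<close> are among those of \<open>j\<close>. The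
  subtraction \<open>j - i\<close> then needs no borrows; it is the set difference \<open>j XOR i\<close>.
\<close>

lemma submask_diff_disjoint:
  assumes "i AND j = (i::nat)"
  shows "i \<le> j" and "i AND (j - i) = 0"
proof -
  have disj: "i AND (j XOR i) = 0"
    using assms by (auto simp: bit_eq_iff bit_simps)
  have "i OR (j XOR i) = j"
    using assms by (auto simp: bit_eq_iff bit_simps)
  then have "i + (j XOR i) = j"
    using disj by (simp add: disjunctive_add_eq_or)
  then show "i \<le> j" and "i AND (j - i) = 0"
    using disj by (metis le_add1, metis add_diff_cancel_left')
qed

lemma submask_iff_diff_disjoint:
  "k AND j = k \<longleftrightarrow> k \<le> j \<and> (j - k) AND k = (0::nat)"
proof (intro iffI conjI)
  assume "k \<le> j \<and> (j - k) AND k = 0"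
  then have "k OR (j - k) = j"
    by (simp add: and.commute flip: disjunctive_add_eq_or)
  then show "k AND j = k"
    by (auto simp: bit_eq_iff bit_simps)
qed (use submask_diff_disjoint in \<open>auto simp: and.commute\<close>)

text \<open>
  This turns the index condition of a Cauchy product with a Sierpinski polynomial into one that is
  symmetric in the two factors \<open>f\<close> and \<open>g\<close>. Either side forces \<open>a\<close> and \<open>j - a\<close> to be complementary
  within \<open>j\<close>; both then say that \<open>k\<close> covers the part of \<open>j\<close> outside \<open>a\<close>.
\<close>

lemma diff_submask_iff_or_eq:
  assumes "k AND j = k" "a \<le> (j::nat)"
  shows "(j - a) AND k = j - a \<longleftrightarrow> a OR k = j"
proof
  assume sub: "(j - a) AND k = j - a"
  have "(j - a) AND j = j - a"
    using sub assms(1) by (metis and.assoc)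
  from submask_diff_disjoint[OF this] have "(j - a) AND a = 0"
    using assms(2) by simp
  then have "(j - a) OR a = j"
    using assms(2) by (simp flip: disjunctive_add_eq_or)
  with sub assms(1) show "a OR k = j"
    by (simp add: bit_eq_iff bit_simps) blast
next
  assume "a OR k = j"
  then have "a AND j = a"
    by (auto simp: bit_eq_iff bit_simps)
  from submask_diff_disjoint[OF this] have "a AND (j - a) = 0" by simp
  moreover from this have "a OR (j - a) = j"
    using assms(2) by (simp flip: disjunctive_add_eq_or)
  ultimately show "(j - a) AND k = j - a"
    using \<open>a OR k = j\<close> by (simp add: bit_eq_iff bit_simps) blast
qed

text \<open>
  The signs of the disjoint masks \<open>a\<close> and \<open>j - a\<close> multiply to that of \<open>j\<close>, and signs are their own
  inverses.
\<close>

lemma thue_morse_diff: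
  assumes "a OR k = (j::nat)"
  shows "a \<le> j" and "thue_morse (j - a) = thue_morse j * thue_morse a"
proof -
  have "a AND j = a"
    using assms by (auto simp: bit_eq_iff bit_simps)
  note * = submask_diff_disjoint[OF this]
  then show "a \<le> j" by simp
  with thue_morse_add_disjoint[OF *(2)] have "thue_morse j = thue_morse a * thue_morse (j - a)"
    by simp
  then show "thue_morse (j - a) = thue_morse j * thue_morse a"
    by (simp add: thue_morse_square mult.commute flip: mult.assoc)
qed

section \<open>Coefficients of the series\<close>

lemma submask_double:
  fixes j m :: nat
  shows "(2 * j) AND (2 * m) = 2 * j \<longleftrightarrow> j AND m = j"
    and "(2 * j) AND Suc (2 * m) = 2 * j \<longleftrightarrow> j AND m = j"
    and "Suc (2 * j) AND (2 * m) \<noteq> Suc (2 * j)"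
    and "Suc (2 * j) AND Suc (2 * m) = Suc (2 * j) \<longleftrightarrow> j AND m = j"
  by (subst and_rec, simp; presburger)+

text \<open>
  Pascal's rule modulo \<open>2\<close>, for the submask relation. Both numbers are split off their last digit; in
  adding \<open>1\<close>, both carry into the next digit only if both are odd, and this is where the induction
  hypothesis enters.
\<close>

lemma submask_Suc_Suc_iff:
  fixes j m :: nat
  shows "Suc j AND Suc m = Suc j \<longleftrightarrow> (j AND m = j) \<noteq> (Suc j AND m = Suc j)"
proof (induction m arbitrary: j rule: less_induct)
  case (less m)
  have Suc2: "Suc (Suc (2 * i)) = 2 * Suc i" for i by simp
  consider (ee) m' j' where "m = 2 * m'" "j = 2 * j'" | (eo) m' j' where "m = 2 * m'" "j = Suc (2 * j')"
    | (oe) m' j' where "m = Suc (2 * m')" "j = 2 * j'" | (oo) m' j' where "m = Suc (2 * m')" "j = Suc (2 * j')"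
    by (metis Suc_eq_plus1 evenE oddE)
  then show ?case
  proof cases
    case ee
    then show ?thesis by (simp only: submask_double) simp
  next
    case eo
    then show ?thesis by (simp only: Suc2 submask_double) simp
  next
    case oe
    then show ?thesis by (simp only: Suc2 submask_double) simp
  next
    case oo
    then show ?thesis
      using less.IH[of m' j'] by (simp only: Suc2 submask_double)
  qed
qed

lemma odd_binomial_iff_submask: "odd (m choose j) \<longleftrightarrow> j AND m = j"
proof (induction m arbitrary: j)
  case 0
  then show ?case by (cases j) auto
next
  case (Suc m)
  then show ?case
    by (cases j) (auto simp: submask_Suc_Suc_iff)
qed

lemma sierpinski_nth: "sierpinski k $ j = of_bool (j AND k = j)"
  using odd_binomial_iff_submask[of k j] by (auto simp: fps_nth_sierpinski mod2_eq_if)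

text \<open>
  Expanding the product chooses a subset of the digits \<open>1\<close> of \<open>k\<close>, that is, a submask; the
  sign counts the chosen digits.
\<close>

lemma sierpinski_bar_nth: "sierpinski_bar k $ j = of_bool (j AND k = j) * thue_morse j"
proof -
  have dec: "set_decode j = {i. bit j i}" for j
    by (auto simp: set_decode_def bit_iff_odd)
  have fin: "finite {i. bit k i}" by (rule finite_bits_nat)
  have "sierpinski_bar k = (\<Sum>A\<in>Pow {i. bit k i}. (-1) ^ card A * fps_X ^ set_encode A)"
    unfolding sierpinski_bar_def by (simp add: prod_diff_conv_sum[OF fin] set_encode_def power_sum)
  also have "\<dots> $ j = (\<Sum>A\<in>Pow {i. bit k i}. if A = {i. bit j i} then (-1) ^ card A else 0)"
    unfolding fps_sum_nth
  proof (rule sum.cong[OF refl])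
    fix A assume "A \<in> Pow {i. bit k i}"
    then have "finite A" using fin by (auto intro: finite_subset)
    then have "set_encode A = j \<longleftrightarrow> A = {i. bit j i}"
      by (metis dec set_decode_inverse set_encode_inverse)
    moreover have "((-1) ^ card A * fps_X ^ set_encode A) $ j =
        (if set_encode A = j then (-1) ^ card A else (0::int))"
      by (cases "even (card A)") (auto simp: fps_X_power_nth)
    ultimately show "((-1) ^ card A * fps_X ^ set_encode A) $ j =
        (if A = {i. bit j i} then (-1) ^ card A else (0::int))" by simp
  qed
  also have "\<dots> = of_bool (j AND k = j) * thue_morse j"
  proof -
    have "{i. bit j i} \<subseteq> {i. bit k i} \<longleftrightarrow> j AND k = j"
      by (auto simp: bit_eq_iff bit_simps)
    then show ?thesis by (simp add: fin thue_morse_def)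
  qed
  finally show ?thesis .
qed

text \<open>
  Each \<open>n\<close> is in exactly one way the sum of a submask of \<open>k\<close> and a mask disjoint from \<open>k\<close>, namely with
  \<open>n AND k\<close> as the submask. Hence the indicator series of the masks disjoint from \<open>k\<close>, multiplied by
  \<^term>\<open>sierpinski k\<close>, is the geometric series.
\<close>

lemma delta_nth: "delta k $ j = of_bool (j AND k = 0)"
proof -
  define D :: "int fps" where "D = Abs_fps (\<lambda>j. of_bool (j AND k = 0))"
  have "sierpinski k * D = Abs_fps (\<lambda>n. 1)"
  proof (rule fps_ext)
    fix n
    have uniq: "(i AND k = i \<and> (n - i) AND k = 0) \<longleftrightarrow> i = n AND k" if "i \<le> n" for i
    proof
      assume *: "i AND k = i \<and> (n - i) AND k = 0"
      then have "i AND (n - i) = 0"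
        by (auto simp: bit_eq_iff bit_simps)
      then have "i OR (n - i) = n"
        using that by (simp flip: disjunctive_add_eq_or)
      with * show "i = n AND k"
        by (simp add: bit_eq_iff bit_simps) blast
    next
      assume i: "i = n AND k"
      then have "i AND n = i" by (auto simp: bit_eq_iff bit_simps)
      note d = submask_diff_disjoint[OF this]
      then have "i OR (n - i) = n" by (simp flip: disjunctive_add_eq_or)
      with i d show "i AND k = i \<and> (n - i) AND k = 0"
        by (simp add: bit_eq_iff bit_simps) blast
    qed
    have "n AND k \<le> n"
      by (rule submask_diff_disjoint) (auto simp: bit_eq_iff bit_simps)
    have "(sierpinski k * D) $ n = (\<Sum>i=0..n. of_bool (i = n AND k))"
      unfolding fps_mult_nth D_def
      by (intro sum.cong refl) (simp add: sierpinski_nth flip: of_bool_conj uniq)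
    also have "\<dots> = 1"
      using \<open>n AND k \<le> n\<close> by (simp add: of_bool_def)
    finally show "(sierpinski k * D) $ n = Abs_fps (\<lambda>n. 1) $ n" by simp
  qed
  then have "(1 - fps_X) * sierpinski k * D = (1 - fps_X) * Abs_fps (\<lambda>n. 1)"
    by (simp add: mult.assoc)
  also have "\<dots> = 1"
    by (rule fps_ext) (simp add: left_diff_distrib)
  finally have "(1 - fps_X) * sierpinski k * D = 1" .
  then have "delta k * ((1 - fps_X) * sierpinski k * D) = delta k"
    by simp
  then have "((1 - fps_X) * sierpinski k * delta k) * D = delta k"
    by (simp only: ac_simps)
  then have "delta k = D"
    by (simp add: delta_inverse)
  then show ?thesis by (simp add: D_def)
qed

lemma X_power_mult_delta_nth: "(fps_X ^ k * delta k) $ j = of_bool (k AND j = k)"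
  by (auto simp: fps_X_power_mult_nth delta_nth submask_iff_diff_disjoint)

section \<open>The signed sum over masks\<close>

lemma sum_lessThan_double:
  fixes h :: "nat \<Rightarrow> 'b::comm_monoid_add"
  shows "(\<Sum>k<2 * M. h k) = (\<Sum>k<M. h (2 * k) + h (Suc (2 * k)))"
  by (induction M) (simp_all add: add.assoc)

lemma or_double:
  fixes x y :: nat
  shows "2 * x OR 2 * y = 2 * (x OR y)" "2 * x OR Suc (2 * y) = Suc (2 * (x OR y))"
    "Suc (2 * x) OR 2 * y = Suc (2 * (x OR y))" "Suc (2 * x) OR Suc (2 * y) = Suc (2 * (x OR y))"
  by (simp_all add: or_rec[of "2 * x"] or_rec[of "Suc (2 * x)"])

lemma and_double:
  fixes x y :: nat
  shows "2 * x AND 2 * y = 2 * (x AND y)" "2 * x AND Suc (2 * y) = 2 * (x AND y)"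
    "Suc (2 * x) AND 2 * y = 2 * (x AND y)" "Suc (2 * x) AND Suc (2 * y) = Suc (2 * (x AND y))"
  by (simp_all add: and_rec[of "2 * x"] and_rec[of "Suc (2 * x)"])

text \<open>
  The induction removes the lowest digit of \<open>a\<close>, \<open>b\<close>, \<open>k\<close> and \<open>p\<close>. The arbitrary weight \<open>\<phi>\<close> plays the part
  of the monomials of a generating function: after the sum over the lowest digits of \<open>k\<close> and \<open>p\<close>, what
  is left is the same sum for the halved numbers with a new weight \<open>\<psi>\<close>, so \<open>\<phi>\<close> has to
  vary in the induction.
\<close>

lemma signed_mask_sum:
  fixes \<phi> :: "nat \<Rightarrow> int"
  assumes "a < 2 ^ N" "b < 2 ^ N"
  shows "(\<Sum>k<2 ^ N. \<Sum>p<2 ^ N. of_bool (a OR k = b OR k \<and> p AND k = 0) *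
            thue_morse k * \<phi> (p + (a OR k))) = thue_morse a * thue_morse b * \<phi> (a + b)"
  using assms
proof (induction N arbitrary: a b \<phi>)
  case 0
  then show ?case by (simp add: thue_morse_def)
next
  case (Suc N)
  define a' b' where "a' = a div 2" "b' = b div 2"
  have less: "a' < 2 ^ N" "b' < 2 ^ N" using Suc.prems by (auto simp: a'_b'_def)
  let ?t = "\<lambda>k p. of_bool (a OR k = b OR k \<and> p AND k = 0) * thue_morse k * \<phi> (p + (a OR k))"
  let ?c = "\<lambda>k p. of_bool (a' OR k = b' OR k \<and> p AND k = 0) * thue_morse k"
  have split: "(\<Sum>k<2 ^ Suc N. \<Sum>p<2 ^ Suc N. ?t k p) = (\<Sum>k<2 ^ N. \<Sum>p<2 ^ N.
      ?t (2 * k) (2 * p) + ?t (2 * k) (Suc (2 * p)) + ?t (Suc (2 * k)) (2 * p) + ?t (Suc (2 * k)) (Suc (2 * p)))"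
    by (simp only: power_Suc sum_lessThan_double sum.distrib add.assoc)
  have reduce: "(\<Sum>k<2 ^ Suc N. \<Sum>p<2 ^ Suc N. ?t k p) = thue_morse a' * thue_morse b' * \<psi> (a' + b')"
    if "\<And>k p. ?t (2 * k) (2 * p) + ?t (2 * k) (Suc (2 * p)) + ?t (Suc (2 * k)) (2 * p) + ?t (Suc (2 * k)) (Suc (2 * p))
         = ?c k p * \<psi> (p + (a' OR k))" for \<psi>
    unfolding split that by (rule Suc.IH[OF less])
  note digits = or_double and_double Suc_double_not_eq_double double_not_eq_Suc_double
    thue_morse_double thue_morse_Suc_double distrib_left
  consider "a = 2 * a'" "b = 2 * b'" | "a = Suc (2 * a')" "b = 2 * b'"
    | "a = 2 * a'" "b = Suc (2 * b')" | "a = Suc (2 * a')" "b = Suc (2 * b')"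
    unfolding a'_b'_def by (metis dvd_mult_div_cancel odd_two_times_div_two_succ Suc_eq_plus1)
  then show ?case
  proof cases
    \<comment> \<open>For \<open>k\<close> even, \<open>p\<close> may be even or odd; \<open>k\<close> odd cancels the term with \<open>p\<close> odd.\<close>
    case 1
    show ?thesis
      by (subst reduce[where \<psi> = "\<lambda>m. \<phi> (2 * m)"])
        (simp_all add: 1 digits)
  next
    \<comment> \<open>Only \<open>k\<close> odd and \<open>p\<close> even is possible when the last digits differ.\<close>
    case 2
    show ?thesis
      by (subst reduce[where \<psi> = "\<lambda>m. - \<phi> (Suc (2 * m))"])
        (simp_all add: 2 digits)
  next
    case 3
    show ?thesis
      by (subst reduce[where \<psi> = "\<lambda>m. - \<phi> (Suc (2 * m))"])
        (simp_all add: 3 digits)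
  next
    \<comment> \<open>Now \<open>k\<close> odd cancels the term with \<open>p\<close> even; the one with \<open>p\<close> odd remains and carries.\<close>
    case 4
    show ?thesis
      by (subst reduce[where \<psi> = "\<lambda>m. \<phi> (Suc (Suc (2 * m)))"])
        (simp_all add: 4 digits)
  qed
qed

text \<open>
  The weight is the indicator of \<open>n\<close>. With it all terms with \<open>k > n\<close> or \<open>p > n\<close> vanish, so the two bounds
  can be moved to a common power of \<open>2\<close>.
\<close>

lemma signed_mask_count:
  assumes "a \<le> n" "b \<le> n" "n < K"
  shows "(\<Sum>k<K. \<Sum>p\<le>n. of_bool (a OR k = b OR k \<and> p AND k = 0) * thue_morse k *
            of_bool (p + (a OR k) = n)) = thue_morse a * thue_morse b * of_bool (a + b = n)"
proof -
  have "K < 2 ^ K" by (rule less_exp)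
  with assms have less: "a < 2 ^ K" "b < 2 ^ K" "n < 2 ^ K" by linarith+
  have large: "p + (a OR k) \<noteq> n" if "k \<ge> K" for p k
    using thue_morse_diff(1)[of k a "a OR k"] that assms(3) by (simp add: or.commute)
  let ?t = "\<lambda>k p. of_bool (a OR k = b OR k \<and> p AND k = 0) * thue_morse k * of_bool (p + (a OR k) = n)"
  have "(\<Sum>k<K. \<Sum>p\<le>n. ?t k p) = (\<Sum>k<2 ^ K. \<Sum>p\<le>n. ?t k p)"
    using \<open>K < 2 ^ K\<close> by (intro sum.mono_neutral_left) (auto simp: large)
  also have "\<dots> = (\<Sum>k<2 ^ K. \<Sum>p<2 ^ K. ?t k p)"
    using less(3) by (intro sum.cong[OF refl, of "{..<2 ^ K}"] sum.mono_neutral_left) auto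
  also have "\<dots> = thue_morse a * thue_morse b * of_bool (a + b = n)"
    by (rule signed_mask_sum[OF less(1,2), where \<phi> = "\<lambda>m. of_bool (m = n)"])
  finally show ?thesis .
qed

section \<open>The convolution formula\<close>

lemma fps_from_int_nth: "fps_from_int u $ j = of_int (u $ j)"
  by (simp add: fps_from_int_def)

lemma termwise_nth: "(u \<odot> v) $ j = u $ j * v $ j"
  by (simp add: termwise_def)

text \<open>
  The series \<open>u\<close> stands for either of the two Sierpinski polynomials, with \<open>w\<close> constant or the sign. The
  summation range \<open>a \<le> n\<close> is wider than the natural \<open>a \<le> j\<close> (the condition \<open>a OR k = j\<close> implies
  \<open>a \<le> j\<close>) to have one range for all \<open>j\<close> that contribute to the coefficient of \<open>x\<^sup>n\<close>.
\<close>

lemma submask_kernel_mult_nth: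
  fixes f :: "'a::comm_ring_1 fps"
  assumes "k AND j = k" "j \<le> n" "\<And>i. u $ i = of_bool (i AND k = i) * w i"
  shows "(fps_from_int u * f) $ j = (\<Sum>a\<le>n. of_bool (a OR k = j) * (of_int (w (j - a)) * f $ a))"
proof -
  have "(fps_from_int u * f) $ j = (\<Sum>a\<le>j. f $ a * of_int (u $ (j - a)))"
    by (subst mult.commute) (simp add: fps_mult_nth fps_from_int_nth atLeast0AtMost)
  also have "\<dots> = (\<Sum>a\<le>j. of_bool (a OR k = j) * (of_int (w (j - a)) * f $ a))"
    by (intro sum.cong refl) (simp add: assms(3) diff_submask_iff_or_eq[OF assms(1)] mult.commute)
  also have "\<dots> = (\<Sum>a\<le>n. of_bool (a OR k = j) * (of_int (w (j - a)) * f $ a))"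
    using assms(2) thue_morse_diff(1)[of _ k j] by (intro sum.mono_neutral_left) auto
  finally show ?thesis .
qed

text \<open>
  The hypothesis captures what the two forms of the identity have in common. It can be restricted to
  the \<open>j\<close> with \<open>k\<close> as a submask because the termwise factor \<^term>\<open>fps_X ^ k * delta k\<close> annihilates the other
  coefficients. The variable \<open>p\<close> is the index of the coefficient taken from the outer factor
  \<^term>\<open>delta k\<close>, and \<open>j = n - p\<close>.
\<close>

lemma summand_nth:
  fixes f g F G :: "'a::comm_ring_1 fps"
  assumes "\<And>j. k AND j = k \<Longrightarrow> j \<le> n \<Longrightarrow> F $ j * G $ j =
      (\<Sum>a\<le>n. \<Sum>b\<le>n. of_bool (a OR k = j \<and> b OR k = j) * (of_int (thue_morse a * thue_morse b) * (f $ a * g $ b)))"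
  shows "(of_int (thue_morse k) * fps_from_int (delta k) * (fps_from_int (fps_X ^ k * delta k) \<odot> F \<odot> G)) $ n =
      (\<Sum>a\<le>n. \<Sum>b\<le>n. of_int (thue_morse a * thue_morse b *
          (\<Sum>p\<le>n. of_bool (a OR k = b OR k \<and> p AND k = 0) * thue_morse k * of_bool (p + (a OR k) = n))) * (f $ a * g $ b))"
proof -
  let ?w = "\<lambda>a b. of_int (thue_morse a * thue_morse b) * (f $ a * g $ b)"
  have W: "(fps_from_int (fps_X ^ k * delta k) \<odot> F \<odot> G) $ j =
      (\<Sum>a\<le>n. \<Sum>b\<le>n. of_bool (a OR k = j \<and> b OR k = j) * ?w a b)" if "j \<le> n" for j
  proof (cases "k AND j = k")
    case True
    then show ?thesis
      using assms[OF True that] by (simp add: termwise_nth fps_from_int_nth X_power_mult_delta_nth mult.assoc)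
  next
    case False
    then have "a OR k \<noteq> j" for a
      by (auto simp: bit_eq_iff bit_simps)
    with False show ?thesis
      by (simp add: termwise_nth fps_from_int_nth X_power_mult_delta_nth)
  qed
  have "(of_int (thue_morse k) * fps_from_int (delta k) * (fps_from_int (fps_X ^ k * delta k) \<odot> F \<odot> G)) $ n =
     of_int (thue_morse k) * (\<Sum>p\<le>n. of_bool (p AND k = 0) * (fps_from_int (fps_X ^ k * delta k) \<odot> F \<odot> G) $ (n - p))"
    unfolding fps_of_int[symmetric] mult.assoc fps_mult_left_const_nth
    by (simp add: fps_mult_nth[of "fps_from_int (delta k)"] fps_from_int_nth delta_nth atLeast0AtMost del: sum_of_bool_mult_eq)
  also have "\<dots> = (\<Sum>p\<le>n. \<Sum>a\<le>n. \<Sum>b\<le>n. of_int (thue_morse k) * (of_bool (p AND k = 0) *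
      (of_bool (a OR k = n - p \<and> b OR k = n - p) * ?w a b)))"
    by (simp only: W[OF diff_le_self] sum_distrib_left)
  also have "\<dots> = (\<Sum>a\<le>n. \<Sum>b\<le>n. \<Sum>p\<le>n. of_int (thue_morse k) * (of_bool (p AND k = 0) *
      (of_bool (a OR k = n - p \<and> b OR k = n - p) * ?w a b)))"
    by (subst sum.swap, rule sum.cong[OF refl], rule sum.swap)
  also have "\<dots> = (\<Sum>a\<le>n. \<Sum>b\<le>n. of_int (thue_morse a * thue_morse b *
          (\<Sum>p\<le>n. of_bool (a OR k = b OR k \<and> p AND k = 0) * thue_morse k * of_bool (p + (a OR k) = n))) * (f $ a * g $ b))"
  proof (intro sum.cong refl)
    fix a b
    show "(\<Sum>p\<le>n. of_int (thue_morse k) * (of_bool (p AND k = 0) *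
      (of_bool (a OR k = n - p \<and> b OR k = n - p) * ?w a b))) =
      of_int (thue_morse a * thue_morse b *
          (\<Sum>p\<le>n. of_bool (a OR k = b OR k \<and> p AND k = 0) * thue_morse k * of_bool (p + (a OR k) = n))) * (f $ a * g $ b)"
      unfolding sum_distrib_left of_int_sum sum_distrib_right
    proof (intro sum.cong refl)
      fix p assume "p \<in> {..n}"
      then have "a OR k = n - p \<and> b OR k = n - p \<longleftrightarrow> a OR k = b OR k \<and> p + (a OR k) = n"
        by auto
      then show "of_int (thue_morse k) * (of_bool (p AND k = 0) *
          (of_bool (a OR k = n - p \<and> b OR k = n - p) * ?w a b)) =
        of_int (thue_morse a * thue_morse b * (of_bool (a OR k = b OR k \<and> p AND k = 0) * thue_morse k *
          of_bool (p + (a OR k) = n))) * (f $ a * g $ b)"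
        by (simp add: of_bool_conj ac_simps)
    qed
  qed
  finally show ?thesis .
qed

text \<open>
  Every \<open>k > n\<close> contributes \<open>0\<close> to the coefficient of \<open>x\<^sup>n\<close>, so that coefficient of the partial
  sums is constant as soon as there are more than \<open>n\<close> summands.
\<close>

lemma convolution_sums:
  fixes f g :: "'a::comm_ring_1 fps" and F G :: "nat \<Rightarrow> 'a fps"
  assumes "\<And>k j n. k AND j = k \<Longrightarrow> j \<le> n \<Longrightarrow> F k $ j * G k $ j =
      (\<Sum>a\<le>n. \<Sum>b\<le>n. of_bool (a OR k = j \<and> b OR k = j) * (of_int (thue_morse a * thue_morse b) * (f $ a * g $ b)))"
  shows "(\<lambda>k. of_int (thue_morse k) * fps_from_int (delta k) *
            (fps_from_int (fps_X ^ k * delta k) \<odot> F k \<odot> G k)) sums (f * g)"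
  (is "?t sums _")
  unfolding sums_def
proof (rule tendsto_fpsI)
  fix n
  have nth: "?t k $ n = (\<Sum>a\<le>n. \<Sum>b\<le>n. of_int (thue_morse a * thue_morse b * (\<Sum>p\<le>n.
        of_bool (a OR k = b OR k \<and> p AND k = 0) * thue_morse k * of_bool (p + (a OR k) = n))) * (f $ a * g $ b))" for k
    by (rule summand_nth) (rule assms)
  have "(\<Sum>k<K. ?t k) $ n = (f * g) $ n" if "n < K" for K
  proof -
    have "(\<Sum>k<K. ?t k) $ n = (\<Sum>a\<le>n. \<Sum>b\<le>n. of_int (thue_morse a * thue_morse b * (\<Sum>k<K. \<Sum>p\<le>n.
        of_bool (a OR k = b OR k \<and> p AND k = 0) * thue_morse k * of_bool (p + (a OR k) = n))) * (f $ a * g $ b))"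
      unfolding fps_sum_nth nth
      by (subst sum.swap, rule sum.cong[OF refl], subst sum.swap)
        (simp only: sum_distrib_left of_int_sum sum_distrib_right)
    also have "\<dots> = (\<Sum>a\<le>n. \<Sum>b\<le>n. of_int (thue_morse a * thue_morse b *
        (thue_morse a * thue_morse b * of_bool (a + b = n))) * (f $ a * g $ b))"
      using that by (intro sum.cong refl) (simp only: signed_mask_count atMost_iff)
    also have "\<dots> = (\<Sum>a\<le>n. \<Sum>b\<le>n. if b = n - a then f $ a * g $ b else 0)"
    proof (intro sum.cong refl)
      fix a b assume "a \<in> {..n}"
      have sq: "thue_morse a * thue_morse b * (thue_morse a * thue_morse b * of_bool (a + b = n))
          = of_bool (a + b = n)"
      proof -
        have "thue_morse a * thue_morse b * (thue_morse a * thue_morse b * of_bool (a + b = n))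
            = (thue_morse a * thue_morse a) * (thue_morse b * thue_morse b) * of_bool (a + b = n)"
          by (simp only: ac_simps)
        then show ?thesis by (simp add: thue_morse_square)
      qed
      show "of_int (thue_morse a * thue_morse b * (thue_morse a * thue_morse b * of_bool (a + b = n))) * (f $ a * g $ b)
        = (if b = n - a then f $ a * g $ b else 0)"
        unfolding sq using \<open>a \<in> {..n}\<close> by auto
    qed
    also have "\<dots> = (f * g) $ n"
      by (simp add: fps_mult_nth atLeast0AtMost)
    finally show ?thesis .
  qed
  from eventually_mono[OF eventually_gt_at_top[of n] this]
  show "eventually (\<lambda>K. (\<Sum>k<K. ?t k) $ n = (f * g) $ n) sequentially" .
qed

theorem theorem4p2:
  fixes f g :: "'a::comm_ring_1 fps"
  shows "(\<lambda>k. of_int (thue_morse k) * fps_from_int (delta k) *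
             (fps_from_int (fps_X ^ k * delta k)
                \<odot> (fps_from_int (sierpinski_bar k) * f)
                \<odot> (fps_from_int (sierpinski_bar k) * g))) sums (f * g)
       \<and> (\<lambda>k. of_int (thue_morse k) * fps_from_int (delta k) *
             (fps_from_int (fps_X ^ k * delta k)
                \<odot> (fps_from_int (sierpinski k) * fps_bar f)
                \<odot> (fps_from_int (sierpinski k) * fps_bar g))) sums (f * g)"
proof (intro conjI convolution_sums)
  fix k j n :: nat
  assume kj: "k AND j = k" "j \<le> n"
  note conv = submask_kernel_mult_nth[OF kj]
  have signs: "thue_morse (j - a) * thue_morse (j - b) = thue_morse a * thue_morse b"
    if "a OR k = j" "b OR k = j" for a b
  proof -
    have "thue_morse (j - a) * thue_morse (j - b) = (thue_morse j * thue_morse j) * (thue_morse a * thue_morse b)"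
      by (simp only: thue_morse_diff(2)[OF that(1)] thue_morse_diff(2)[OF that(2)] ac_simps)
    then show ?thesis by (simp add: thue_morse_square)
  qed
  show "(fps_from_int (sierpinski_bar k) * f) $ j * (fps_from_int (sierpinski_bar k) * g) $ j =
      (\<Sum>a\<le>n. \<Sum>b\<le>n. of_bool (a OR k = j \<and> b OR k = j) * (of_int (thue_morse a * thue_morse b) * (f $ a * g $ b)))"
    unfolding conv[OF sierpinski_bar_nth] sum_product
  proof (intro sum.cong refl)
    fix a b
    show "of_bool (a OR k = j) * (of_int (thue_morse (j - a)) * f $ a) *
        (of_bool (b OR k = j) * (of_int (thue_morse (j - b)) * g $ b)) =
      of_bool (a OR k = j \<and> b OR k = j) * (of_int (thue_morse a * thue_morse b) * (f $ a * g $ b))"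
    proof (cases "a OR k = j \<and> b OR k = j")
      case True
      then show ?thesis by (simp add: ac_simps flip: signs)
    qed auto
  qed
  have sierpinski_nth': "sierpinski k $ i = of_bool (i AND k = i) * 1" for i
    by (simp add: sierpinski_nth)
  show "(fps_from_int (sierpinski k) * fps_bar f) $ j * (fps_from_int (sierpinski k) * fps_bar g) $ j =
      (\<Sum>a\<le>n. \<Sum>b\<le>n. of_bool (a OR k = j \<and> b OR k = j) * (of_int (thue_morse a * thue_morse b) * (f $ a * g $ b)))"
    unfolding conv[OF sierpinski_nth'] sum_product
    by (intro sum.cong refl) (simp add: fps_bar_def of_bool_conj ac_simps)
qed

end
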